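(* Let $f$ and $g$ be homogeneous symmetric functions with nonnegative monomial coefficients. If both $f$ and $g$ are strongly nice, then the product $fg$ is strongly nice. Consequently, the disjoint union of two strongly nice graphs is strongly nice.
   Context: Symmetric functions are over $\mathbb Q$ in variables $x_1,x_2,\ldots$; $m_\lambda$ denotes the monomial symmetric function, and the monomial coefficients of $f$ are the $a_\lambda$ in $f=\sum_\lambda a_\lambda m_\lambda$. For partitions $\lambda,\mu\vdash n$, $\lambda\ge\mu$ (dominance order) means $\sum_{i=1}^k\lambda_i\ge\sum_{i=1}^k\mu_i$ for every $k\ge1$ (parts beyond the length are $0$). A homogeneous symmetric function $f=\sum_{\lambda\vdash n}a_\lambda m_\lambda$ of degree $n$ is strongly nice if $a_\lambda\le a_\mu$ for all partitions $\lambda,\mu\vdash n$ with $\lambda\ge\mu$. For a finite simple graph $G=(V,E)$, the chromatic symmetric function is $X_G=\sum_{\kappa}\prod_{v\in V}x_{\kappa(v)}$, where the sum ranges over all proper colorings $\kappa:V\to\mathbb N=\{1,2,\ldots\}$. The graph $G$ is strongly nice if $X_G$ is strongly nice. *)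

theory Defs
  imports
    Complex_Main
    "HOL-Library.FuncSet"
    "HOL-Library.Multiset"
    "HOL-Library.Poly_Mapping"
    "HOL-Combinatorics.Permutations"
begin

text \<open>
  A monomial in countably many commuting variables is given by its finitely supported exponent
  vector, and a formal power series over the rationals by its coefficients. The variables are
  indexed by \<^typ>\<open>nat\<close>, so index \<open>i\<close> stands for \<open>x\<^sub>i\<^sub>+\<^sub>1\<close>.
\<close>

type_synonym expo = "nat \<Rightarrow>\<^sub>0 nat"
type_synonym series = "expo \<Rightarrow> rat"

definition total_degree :: "expo \<Rightarrow> nat" where
  "total_degree \<alpha> = (\<Sum>i\<in>Poly_Mapping.keys \<alpha>. Poly_Mapping.lookup \<alpha> i)"

definition symmetric :: "series \<Rightarrow> bool" where
  "symmetric f \<longleftrightarrow> (\<forall>\<pi> \<alpha>. bij \<pi> \<longrightarrow> f (Poly_Mapping.map_key \<pi> \<alpha>) = f \<alpha>)"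

definition homogeneous :: "nat \<Rightarrow> series \<Rightarrow> bool" where
  "homogeneous n f \<longleftrightarrow> (\<forall>\<alpha>. f \<alpha> \<noteq> 0 \<longrightarrow> total_degree \<alpha> = n)"

text \<open>Homogeneity includes the bounded degree required of a symmetric function.\<close>

definition homogeneous_symmetric :: "nat \<Rightarrow> series \<Rightarrow> bool" where
  "homogeneous_symmetric n f \<longleftrightarrow> symmetric f \<and> homogeneous n f"

definition series_mult :: "series \<Rightarrow> series \<Rightarrow> series" (infixl "\<otimes>" 70) where
  "(f \<otimes> g) \<gamma> = (\<Sum>(\<alpha>, \<beta>) \<in> {(\<alpha>, \<beta>). \<alpha> + \<beta> = \<gamma>}. f \<alpha> * g \<beta>)"

definition partitions :: "nat \<Rightarrow> nat list set" where
  "partitions n = {ps. sorted_wrt (\<ge>) ps \<and> (\<forall>p\<in>set ps. 0 < p) \<and> sum_list ps = n}"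

definition dominates :: "nat list \<Rightarrow> nat list \<Rightarrow> bool" where
  "dominates ps qs \<longleftrightarrow> (\<forall>k\<ge>1. sum_list (take k qs) \<le> sum_list (take k ps))"

definition exponents :: "expo \<Rightarrow> nat multiset" where
  "exponents \<alpha> = image_mset (Poly_Mapping.lookup \<alpha>) (mset_set (Poly_Mapping.keys \<alpha>))"

text \<open>\<open>m\<^sub>\<lambda>\<close> is the sum of all distinct monomials whose nonzero exponents are the parts of \<open>\<lambda>\<close>.\<close>

definition monomial_sym :: "nat list \<Rightarrow> series" where
  "monomial_sym ps \<alpha> = (if exponents \<alpha> = mset ps then 1 else 0)"

text \<open>
  The coefficients \<open>a\<^sub>\<lambda>\<close> in the expansion \<open>f = (\<Sum>\<lambda> \<turnstile> n. a\<^sub>\<lambda> m\<^sub>\<lambda>)\<close>; the value off the partitions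
  of \<open>n\<close> is fixed to make the description unique. Existence and uniqueness for homogeneous
  symmetric functions are lemma \<open>monomial_coeff_expansion\<close> and \<open>monomial_coeff_unique\<close>.
\<close>

definition monomial_expansion :: "nat \<Rightarrow> series \<Rightarrow> (nat list \<Rightarrow> rat) \<Rightarrow> bool" where
  "monomial_expansion n f a \<longleftrightarrow>
     (\<forall>ps. ps \<notin> partitions n \<longrightarrow> a ps = 0) \<and>
     f = (\<lambda>\<alpha>. \<Sum>ps\<in>partitions n. a ps * monomial_sym ps \<alpha>)"

definition monomial_coeff :: "nat \<Rightarrow> series \<Rightarrow> nat list \<Rightarrow> rat" where
  "monomial_coeff n f = (THE a. monomial_expansion n f a)"

definition strongly_nice :: "nat \<Rightarrow> series \<Rightarrow> bool" where
  "strongly_nice n f \<longleftrightarrow> homogeneous_symmetric n f \<and>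
     (\<forall>ps\<in>partitions n. \<forall>qs\<in>partitions n.
        dominates ps qs \<longrightarrow> monomial_coeff n f ps \<le> monomial_coeff n f qs)"

definition simple_graph :: "'a set \<Rightarrow> 'a set set \<Rightarrow> bool" where
  "simple_graph V E \<longleftrightarrow> finite V \<and> (\<forall>e\<in>E. e \<subseteq> V \<and> card e = 2)"

text \<open>Colorings are extensional, so that they correspond exactly to functions on \<open>V\<close>.\<close>

definition proper_colorings :: "'a set \<Rightarrow> 'a set set \<Rightarrow> ('a \<Rightarrow> nat) set" where
  "proper_colorings V E =
     {\<kappa> \<in> V \<rightarrow>\<^sub>E UNIV. \<forall>u\<in>V. \<forall>v\<in>V. {u, v} \<in> E \<longrightarrow> \<kappa> u \<noteq> \<kappa> v}"

definition coloring_expo :: "'a set \<Rightarrow> ('a \<Rightarrow> nat) \<Rightarrow> expo" where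
  "coloring_expo V \<kappa> = (\<Sum>v\<in>V. Poly_Mapping.single (\<kappa> v) 1)"

text \<open>
  The coefficient of \<open>x\<^sup>\<alpha>\<close> in the formal sum over all proper colorings is the number of
  those whose monomial is \<open>x\<^sup>\<alpha>\<close>.
\<close>

definition chromatic_sym :: "'a set \<Rightarrow> 'a set set \<Rightarrow> series" where
  "chromatic_sym V E \<alpha> = of_nat (card {\<kappa> \<in> proper_colorings V E. coloring_expo V \<kappa> = \<alpha>})"

definition strongly_nice_graph :: "'a set \<Rightarrow> 'a set set \<Rightarrow> bool" where
  "strongly_nice_graph V E \<longleftrightarrow> strongly_nice (card V) (chromatic_sym V E)"

definition disjoint_union_edges :: "'a set set \<Rightarrow> 'b set set \<Rightarrow> ('a + 'b) set set" where
  "disjoint_union_edges E F = image Inl ` E \<union> image Inr ` F"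


subsection \<open>The sums and cardinalities above range over finite sets\<close>

lemma finite_decompositions: "finite {(\<alpha>, \<beta>). \<alpha> + \<beta> = (\<gamma> :: expo)}"
proof -
  let ?K = "Poly_Mapping.keys \<gamma>" and ?l = "Poly_Mapping.lookup"
  let ?S = "{(\<alpha>, \<beta>). \<alpha> + \<beta> = \<gamma>}"
  have fst_inj: "inj_on (\<lambda>(\<alpha>, \<beta>). restrict (?l \<alpha>) ?K) ?S"
  proof (rule inj_onI)
    fix x y
    assume xy: "x \<in> ?S" "y \<in> ?S"
      "(case x of (\<alpha>, \<beta>) \<Rightarrow> restrict (?l \<alpha>) ?K) = (case y of (\<alpha>, \<beta>) \<Rightarrow> restrict (?l \<alpha>) ?K)"
    obtain \<alpha> \<beta> \<alpha>' \<beta>' where x: "x = (\<alpha>, \<beta>)" and y: "y = (\<alpha>', \<beta>')"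
      by (metis surj_pair)
    have *: "restrict (?l \<alpha>) ?K = restrict (?l \<alpha>') ?K" and
      g: "\<alpha>' + \<beta>' = \<alpha> + \<beta>" "\<gamma> = \<alpha> + \<beta>"
      using xy by (auto simp: x y)
    have "?l \<alpha> i = ?l \<alpha>' i" for i
    proof (cases "i \<in> ?K")
      case True
      then show ?thesis using fun_cong[OF *, of i] by (simp only: restrict_apply if_True)
    next
      case False
      then have "?l (\<alpha> + \<beta>) i = 0" "?l (\<alpha>' + \<beta>') i = 0"
        using g by (simp_all add: in_keys_iff)
      then show ?thesis by (simp add: lookup_add)
    qed
    then have "\<alpha> = \<alpha>'" by (simp add: poly_mapping_eqI)
    then show "x = y" using g by (simp add: x y)
  qed
  have "(\<lambda>(\<alpha>, \<beta>). restrict (?l \<alpha>) ?K) ` ?S \<subseteq> (\<Pi>\<^sub>E i\<in>?K. {..?l \<gamma> i})"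
    by (auto simp: lookup_add)
  moreover have "finite (\<Pi>\<^sub>E i\<in>?K. {..?l \<gamma> i})"
    by (intro finite_PiE) auto
  ultimately have "finite ((\<lambda>(\<alpha>, \<beta>). restrict (?l \<alpha>) ?K) ` ?S)"
    by (rule finite_subset)
  then show ?thesis using fst_inj by (rule finite_imageD)
qed

lemma length_le_sum_list: "(\<forall>p\<in>set ps. 0 < p) \<Longrightarrow> length ps \<le> sum_list (ps :: nat list)"
  by (induction ps) auto

lemma finite_partitions: "finite (partitions n)"
proof (rule finite_subset)
  show "partitions n \<subseteq> {ps. set ps \<subseteq> {..n} \<and> length ps \<le> n}"
    using length_le_sum_list by (auto simp: partitions_def member_le_sum_list)
  show "finite {ps. set ps \<subseteq> {..n} \<and> length ps \<le> n}"
    by (rule finite_lists_length_le) simp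
qed

lemma lookup_coloring_expo:
  "finite V \<Longrightarrow> Poly_Mapping.lookup (coloring_expo V \<kappa>) i = card {v\<in>V. \<kappa> v = i}"
proof -
  assume V: "finite V"
  have "Poly_Mapping.lookup (coloring_expo V \<kappa>) i = (\<Sum>v\<in>V. if \<kappa> v = i then 1 else 0)"
    unfolding coloring_expo_def lookup_sum by (intro sum.cong) (auto simp: lookup_single when_def)
  also have "\<dots> = card {v\<in>V. \<kappa> v = i}"
    using V by (simp flip: sum.inter_filter)
  finally show ?thesis .
qed

lemma finite_colorings:
  assumes "finite V"
  shows "finite {\<kappa> \<in> proper_colorings V E. coloring_expo V \<kappa> = \<alpha>}"
proof (rule finite_subset)
  show "{\<kappa> \<in> proper_colorings V E. coloring_expo V \<kappa> = \<alpha>} \<subseteq> V \<rightarrow>\<^sub>E Poly_Mapping.keys \<alpha>"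
  proof (clarify, rule PiE_I)
    fix \<kappa> :: "'a \<Rightarrow> nat" and v assume "v \<in> V"
    then have "{w\<in>V. \<kappa> w = \<kappa> v} \<noteq> {}" by auto
    then have "card {w\<in>V. \<kappa> w = \<kappa> v} \<noteq> 0" using assms by simp
    then show "\<kappa> v \<in> Poly_Mapping.keys (coloring_expo V \<kappa>)"
      using lookup_coloring_expo[OF assms] by (simp add: in_keys_iff)
  next
    fix \<kappa> v assume "\<kappa> \<in> proper_colorings V E" "v \<notin> V"
    then show "\<kappa> v = undefined" by (auto simp: proper_colorings_def PiE_def extensional_def)
  qed
  show "finite (V \<rightarrow>\<^sub>E Poly_Mapping.keys \<alpha>)"
    using assms by (intro finite_PiE) auto
qed


subsection \<open>The monomial expansion exists and is unique\<close>

lemma partitions_eq_if_mset_eq: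
  assumes "ps \<in> partitions m" "qs \<in> partitions n" "mset ps = mset qs"
  shows "ps = qs"
proof -
  have "sorted (rev ps)" "sorted (rev qs)"
    using assms by (auto simp: partitions_def sorted_wrt_rev)
  then have "rev ps = rev qs"
    using assms(3) by (metis mset_rev properties_for_sort)
  then show ?thesis by simp
qed

lemma partition_exists:
  obtains ps where "ps \<in> partitions (total_degree \<alpha>)" "exponents \<alpha> = mset ps"
proof
  let ?ps = "rev (sorted_list_of_multiset (exponents \<alpha>))"
  show e: "exponents \<alpha> = mset ?ps" by simp
  have "sum_list ?ps = sum_mset (exponents \<alpha>)"
    by (metis e sum_mset_sum_list)
  also have "\<dots> = total_degree \<alpha>"
    by (simp add: exponents_def total_degree_def sum_unfold_sum_mset)
  finally have "sum_list ?ps = total_degree \<alpha>" .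
  moreover have "\<forall>p\<in>set ?ps. 0 < p"
    by (auto simp: exponents_def in_keys_iff)
  moreover have "sorted_wrt (\<ge>) ?ps"
    by (simp add: sorted_wrt_rev)
  ultimately show "?ps \<in> partitions (total_degree \<alpha>)"
    by (simp add: partitions_def)
qed

lemma exponents_nth:
  assumes "ps \<in> partitions n"
  shows "exponents (Poly_Mapping.nth ps) = mset ps"
proof -
  have nz: "ps ! i \<noteq> 0" if "i < length ps" for i
    using assms that by (auto simp: partitions_def)
  have keys: "Poly_Mapping.keys (Poly_Mapping.nth ps) = {..<length ps}"
    using nz by (auto simp: in_keys_iff nth.rep_eq nth_default_def simp del: keys_nth split: if_splits)
  have "exponents (Poly_Mapping.nth ps) = image_mset ((!) ps) (mset_set {..<length ps})"
    unfolding exponents_def keys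
    by (intro image_mset_cong) (auto simp: nth.rep_eq nth_default_def)
  also have "\<dots> = mset (map ((!) ps) [0..<length ps])"
    by (simp add: atLeast0LessThan)
  finally show ?thesis by (simp add: map_nth)
qed

lemma symmetric_exponents:
  assumes "symmetric f" "exponents \<alpha> = exponents \<beta>"
  shows "f \<alpha> = f \<beta>"
proof -
  let ?l = "Poly_Mapping.lookup" and ?k = "Poly_Mapping.keys"
  let ?A = "?k \<alpha> \<union> ?k \<beta>"
  have split: "image_mset (?l \<gamma>) (mset_set ?A)
      = exponents \<gamma> + replicate_mset (card ?A - size (exponents \<gamma>)) 0"
    if "?k \<gamma> \<subseteq> ?A" for \<gamma>
  proof -
    have "mset_set ?A = mset_set (?k \<gamma>) + mset_set (?A - ?k \<gamma>)"
      using that by (subst mset_set_Union[symmetric]) (auto simp: Un_absorb1)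
    moreover have "image_mset (?l \<gamma>) (mset_set (?A - ?k \<gamma>))
        = image_mset (\<lambda>_. 0) (mset_set (?A - ?k \<gamma>))"
      by (intro image_mset_cong) (auto simp: in_keys_iff)
    moreover have "card (?A - ?k \<gamma>) = card ?A - size (exponents \<gamma>)"
      using that by (simp add: card_Diff_subset exponents_def)
    ultimately show ?thesis by (simp add: exponents_def image_mset_const_eq)
  qed
  have "image_mset (?l \<alpha>) (mset_set ?A) = image_mset (?l \<beta>) (mset_set ?A)"
    using split[of \<alpha>] split[of \<beta>] assms(2) by simp
  then obtain p where p: "p permutes ?A" "\<forall>i\<in>?A. ?l \<alpha> i = ?l \<beta> (p i)"
    using image_mset_eq_implies_permutes[of ?A "?l \<alpha>" "?l \<beta>"] by auto
  have "?l \<alpha> i = ?l \<beta> (p i)" for i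
  proof (cases "i \<in> ?A")
    case False
    then show ?thesis using p(1) by (auto simp: permutes_not_in in_keys_iff)
  qed (use p in blast)
  then have "\<alpha> = Poly_Mapping.map_key p \<beta>"
    using permutes_inj[OF p(1)] by (intro poly_mapping_eqI) (simp add: map_key.rep_eq)
  then show ?thesis
    using assms(1) permutes_bij[OF p(1)] by (simp add: symmetric_def)
qed

lemma monomial_expansion_nth:
  assumes "monomial_expansion n f a" "ps \<in> partitions n"
  shows "a ps = f (Poly_Mapping.nth ps)"
proof -
  have "f (Poly_Mapping.nth ps)
      = (\<Sum>qs\<in>partitions n. a qs * monomial_sym qs (Poly_Mapping.nth ps))"
    using assms(1) unfolding monomial_expansion_def by (auto dest: fun_cong)
  also have "\<dots> = (\<Sum>qs\<in>partitions n. if qs = ps then a ps else 0)"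
  proof (rule sum.cong[OF refl])
    fix qs assume "qs \<in> partitions n"
    then show "a qs * monomial_sym qs (Poly_Mapping.nth ps) = (if qs = ps then a ps else 0)"
      using partitions_eq_if_mset_eq[OF assms(2), of qs n]
      by (auto simp: monomial_sym_def exponents_nth[OF assms(2)])
  qed
  also have "\<dots> = a ps" using assms(2) finite_partitions by simp
  finally show ?thesis ..
qed

lemma monomial_expansion_unique:
  assumes "monomial_expansion n f a" "monomial_expansion n f b"
  shows "a = b"
proof
  fix ps show "a ps = b ps"
    using assms monomial_expansion_nth[OF assms(1)] monomial_expansion_nth[OF assms(2)]
    by (cases "ps \<in> partitions n") (auto simp: monomial_expansion_def)
qed

lemma monomial_expansion_exists:
  assumes "homogeneous_symmetric n f"
  shows "monomial_expansion n f
           (\<lambda>ps. if ps \<in> partitions n then f (Poly_Mapping.nth ps) else 0)"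
proof -
  have "f \<alpha> = (\<Sum>ps\<in>partitions n. f (Poly_Mapping.nth ps) * monomial_sym ps \<alpha>)" for \<alpha>
  proof -
    obtain rs where rs: "rs \<in> partitions (total_degree \<alpha>)" "exponents \<alpha> = mset rs"
      by (rule partition_exists)
    have "(\<Sum>ps\<in>partitions n. f (Poly_Mapping.nth ps) * monomial_sym ps \<alpha>)
        = (\<Sum>ps\<in>partitions n. if ps = rs then f \<alpha> else 0)"
    proof (rule sum.cong[OF refl])
      fix ps assume ps: "ps \<in> partitions n"
      show "f (Poly_Mapping.nth ps) * monomial_sym ps \<alpha> = (if ps = rs then f \<alpha> else 0)"
      proof (cases "ps = rs")
        case True
        then have "f (Poly_Mapping.nth ps) = f \<alpha>"
          using assms rs exponents_nth[OF rs(1)]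
          by (intro symmetric_exponents) (auto simp: homogeneous_symmetric_def)
        then show ?thesis using True rs by (simp add: monomial_sym_def)
      next
        case False
        then have "exponents \<alpha> \<noteq> mset ps"
          using partitions_eq_if_mset_eq[OF rs(1) ps] rs(2) by auto
        then show ?thesis using False by (simp add: monomial_sym_def)
      qed
    qed
    also have "\<dots> = (if rs \<in> partitions n then f \<alpha> else 0)"
      using finite_partitions by simp
    also have "\<dots> = f \<alpha>"
      using assms rs(1)
      by (auto simp: homogeneous_symmetric_def homogeneous_def)
    finally show ?thesis ..
  qed
  then have "f = (\<lambda>\<alpha>. \<Sum>ps\<in>partitions n. f (Poly_Mapping.nth ps) * monomial_sym ps \<alpha>)"
    by blast
  also have "\<dots> = (\<lambda>\<alpha>. \<Sum>ps\<in>partitions n.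
      (if ps \<in> partitions n then f (Poly_Mapping.nth ps) else 0) * monomial_sym ps \<alpha>)"
    by simp
  finally show ?thesis unfolding monomial_expansion_def by simp
qed

lemma monomial_coeff_unique:
  "monomial_expansion n f a \<Longrightarrow> monomial_coeff n f = a"
  unfolding monomial_coeff_def by (blast intro: the_equality monomial_expansion_unique)

lemma monomial_coeff_expansion:
  "homogeneous_symmetric n f \<Longrightarrow> monomial_expansion n f (monomial_coeff n f)"
  using monomial_coeff_unique monomial_expansion_exists by metis


subsection \<open>Chromatic symmetric functions are homogeneous symmetric functions\<close>

lemma chromatic_sym_homogeneous_symmetric:
  assumes V: "finite V"
  shows "homogeneous_symmetric (card V) (chromatic_sym V E)"
proof -
  let ?C = "\<lambda>\<alpha>. {\<kappa> \<in> proper_colorings V E. coloring_expo V \<kappa> = \<alpha>}"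
  have "total_degree \<alpha> = card V" if "chromatic_sym V E \<alpha> \<noteq> 0" for \<alpha>
  proof -
    have "?C \<alpha> \<noteq> {}" using that unfolding chromatic_sym_def by force
    then obtain \<kappa> where \<alpha>: "\<alpha> = coloring_expo V \<kappa>" by blast
    have "Poly_Mapping.keys \<alpha> = \<kappa> ` V"
      using V by (auto simp: \<alpha> in_keys_iff lookup_coloring_expo)
    then have "total_degree \<alpha> = (\<Sum>i\<in>\<kappa> ` V. card {v\<in>V. \<kappa> v = i})"
      by (simp add: total_degree_def \<alpha> lookup_coloring_expo[OF V])
    also have "\<dots> = card V"
      using sum.image_gen[OF V, of "\<lambda>_. 1 :: nat" \<kappa>] by simp
    finally show ?thesis .
  qed
  moreover have "chromatic_sym V E (Poly_Mapping.map_key \<pi> \<alpha>) = chromatic_sym V E \<alpha>"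
    if \<pi>: "bij \<pi>" for \<pi> \<alpha>
  proof -
    have inj: "inj \<pi>" and surj: "surj \<pi>" using \<pi> by (auto simp: bij_def)
    have expo: "coloring_expo V (restrict (\<pi> \<circ> \<kappa>) V) = \<alpha> \<longleftrightarrow>
        coloring_expo V \<kappa> = Poly_Mapping.map_key \<pi> \<alpha>" for \<kappa>
    proof -
      have "Poly_Mapping.lookup (coloring_expo V (restrict (\<pi> \<circ> \<kappa>) V)) (\<pi> i)
          = Poly_Mapping.lookup (coloring_expo V \<kappa>) i" for i
        unfolding lookup_coloring_expo[OF V]
        by (rule arg_cong[where f = card]) (auto dest: injD[OF inj])
      then show ?thesis
        using surj inj unfolding poly_mapping_eq_iff fun_eq_iff
        by (simp add: map_key.rep_eq) (metis surjD)
    qed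
    have "bij_betw (\<lambda>\<kappa>. restrict (\<pi> \<circ> \<kappa>) V) (?C (Poly_Mapping.map_key \<pi> \<alpha>)) (?C \<alpha>)"
    proof (rule bij_betw_byWitness[where f' = "\<lambda>\<kappa>. restrict (inv \<pi> \<circ> \<kappa>) V"])
      show "\<forall>\<kappa>\<in>?C (Poly_Mapping.map_key \<pi> \<alpha>).
          restrict (inv \<pi> \<circ> restrict (\<pi> \<circ> \<kappa>) V) V = \<kappa>"
        using inj by (auto simp: proper_colorings_def restrict_def PiE_def extensional_def)
      show *: "\<forall>\<kappa>\<in>?C \<alpha>. restrict (\<pi> \<circ> restrict (inv \<pi> \<circ> \<kappa>) V) V = \<kappa>"
        using surj by (auto simp: proper_colorings_def restrict_def PiE_def extensional_def
            surj_f_inv_f)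
      show "(\<lambda>\<kappa>. restrict (\<pi> \<circ> \<kappa>) V) ` ?C (Poly_Mapping.map_key \<pi> \<alpha>) \<subseteq> ?C \<alpha>"
        using inj expo by (auto simp: proper_colorings_def inj_eq)
      show "(\<lambda>\<kappa>. restrict (inv \<pi> \<circ> \<kappa>) V) ` ?C \<alpha> \<subseteq> ?C (Poly_Mapping.map_key \<pi> \<alpha>)"
      proof clarify
        fix \<kappa> assume \<kappa>: "\<kappa> \<in> proper_colorings V E" "\<alpha> = coloring_expo V \<kappa>"
        let ?\<kappa>' = "restrict (inv \<pi> \<circ> \<kappa>) V"
        have "restrict (\<pi> \<circ> ?\<kappa>') V = \<kappa>" using * \<kappa> by blast
        then have "coloring_expo V ?\<kappa>' = Poly_Mapping.map_key \<pi> \<alpha>"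
          using expo[of ?\<kappa>'] \<kappa>(2) by simp
        moreover have "?\<kappa>' \<in> proper_colorings V E"
          using \<kappa>(1) by (auto simp: proper_colorings_def dest: injD[OF surj_imp_inj_inv[OF surj]])
        ultimately show "?\<kappa>' \<in> proper_colorings V E \<and>
            coloring_expo V ?\<kappa>' = Poly_Mapping.map_key \<pi> (coloring_expo V \<kappa>)"
          using \<kappa>(2) by simp
      qed
    qed
    then show ?thesis unfolding chromatic_sym_def by (simp add: bij_betw_same_card)
  qed
  ultimately show ?thesis
    by (auto simp: homogeneous_symmetric_def homogeneous_def symmetric_def)
qed

end

theory Submission
  imports Defs
begin

text \<open>
  A symmetric function is strongly nice exactly when moving one unit from a larger exponent to a
  smaller one never decreases its coefficient: such unit transfers preserve the degree and
  generate the dominance order. Dominance is handled through the truncated sums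
  \<open>\<Sum>\<^sub>i max(\<alpha>\<^sub>i - t, 0)\<close>, called excesses here: \<open>\<lambda>\<close> dominates \<open>\<mu>\<close> iff every excess of \<open>\<lambda>\<close> is at least
  that of \<open>\<mu>\<close> (\<open>dominates_iff_excess\<close>). Unlike partial sums of sorted parts, excesses
  do not refer to an ordering of the variables, so they apply to exponent vectors directly
  (\<open>strongly_nice_iff_majorizes\<close>), and their second difference in \<open>t\<close> counts the exponents equal
  to \<open>t + 1\<close>, which locates the transfers that lead from one vector to another
  (\<open>mono_on_majorization_if_unit_transfers\<close>).

  It remains to compare the coefficients of \<open>fg\<close> at \<open>\<delta> + e\<^sub>i\<close> and \<open>\<delta> + e\<^sub>j\<close> for \<open>\<delta>\<^sub>j < \<delta>\<^sub>i\<close>, where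
  \<open>e\<^sub>i\<close> is the unit vector at \<open>i\<close>. Extend the coefficient functions by zero to integer vectors and let
  \<open>s\<close> exchange the coordinates \<open>i\<close> and \<open>j\<close>. Since \<open>f(v + e\<^sub>j) - f(v + e\<^sub>i)\<close> changes its sign under
  \<open>v \<mapsto> s v\<close>, averaging the sum for the difference over \<open>v\<close> and \<open>s v\<close> gives
  \<open>2 ((fg)(\<delta> + e\<^sub>j) - (fg)(\<delta> + e\<^sub>i)) = (\<Sum>v. (f(v + e\<^sub>j) - f(v + e\<^sub>i)) (g(\<delta> - v) - g(\<delta> - s v)))\<close>.
  Both factors are nonnegative if \<open>v\<^sub>i \<ge> v\<^sub>j\<close> and nonpositive otherwise, so every term is nonnegative
  (\<open>series_mult_unit_transfer\<close>). Nonnegativity of the coefficients enters because the extension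
  by zero must still be monotone when a transfer leads from a vector with a negative entry to one
  without.

  The claim on graphs follows because the chromatic symmetric function has nonnegative
  coefficients and turns disjoint unions into products (\<open>chromatic_sym_disjoint_union\<close>).
\<close>

section \<open>Dominance through excesses\<close>

definition excess :: "nat \<Rightarrow> expo \<Rightarrow> nat" where
  "excess t \<alpha> = (\<Sum>i\<in>Poly_Mapping.keys \<alpha>. Poly_Mapping.lookup \<alpha> i - t)"

lemma excess_superset:
  assumes "finite A" "Poly_Mapping.keys \<alpha> \<subseteq> A"
  shows "excess t \<alpha> = (\<Sum>i\<in>A. Poly_Mapping.lookup \<alpha> i - t)"
  unfolding excess_def using assms by (intro sum.mono_neutral_left) (auto simp: in_keys_iff)

lemma excess_0: "excess 0 \<alpha> = total_degree \<alpha>"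
  by (simp add: excess_def total_degree_def)

lemma excess_exponents: "excess t \<alpha> = sum_mset (image_mset (\<lambda>x. x - t) (exponents \<alpha>))"
  by (simp add: excess_def exponents_def sum_unfold_sum_mset image_mset.compositionality comp_def)

lemma excess_list:
  "exponents \<alpha> = mset ps \<Longrightarrow> excess t \<alpha> = (\<Sum>p\<leftarrow>ps. p - t)"
  unfolding excess_exponents by (metis mset_map sum_mset_sum_list)

lemma sum_list_le_sum_list_diff: "sum_list xs \<le> (\<Sum>x\<leftarrow>xs. x - t) + length xs * (t::nat)"
  by (induction xs) auto

text \<open>
  With equality for \<open>t\<close> between the \<open>k\<close>-th and the next part of a weakly decreasing list, this
  bound expresses partial sums through excesses (minimise over \<open>t\<close>) and excesses through partial
  sums (maximise over \<open>k\<close>).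
\<close>
lemma sum_take_le_excess: "sum_list (take k ps) \<le> (\<Sum>p\<leftarrow>ps. p - t) + k * (t::nat)"
proof -
  have "sum_list (take k ps) \<le> (\<Sum>p\<leftarrow>take k ps. p - t) + length (take k ps) * t"
    by (rule sum_list_le_sum_list_diff)
  also have "\<dots> \<le> (\<Sum>p\<leftarrow>ps. p - t) + k * t"
  proof (rule add_mono)
    have "(\<Sum>p\<leftarrow>ps. p - t) = (\<Sum>p\<leftarrow>take k ps. p - t) + (\<Sum>p\<leftarrow>drop k ps. p - t)"
      by (metis append_take_drop_id map_append sum_list_append)
    then show "(\<Sum>p\<leftarrow>take k ps. p - t) \<le> (\<Sum>p\<leftarrow>ps. p - t)" by simp
  qed simp
  finally show ?thesis .
qed

lemma excess_eq_sum_take: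
  assumes "sorted_wrt (\<ge>) qs"
  shows "sum_list (take (length (filter (\<lambda>q. t < q) qs)) qs)
       = (\<Sum>q\<leftarrow>qs. q - t) + length (filter (\<lambda>q. t < q) qs) * (t::nat)"
  using assms
proof (induction qs)
  case (Cons x qs)
  show ?case
  proof (cases "t < x")
    case False
    then have "\<forall>q\<in>set qs. q \<le> t" using Cons.prems by auto
    then have "filter (\<lambda>q. t < q) qs = []" "(\<Sum>q\<leftarrow>qs. q - t) = 0"
      by (auto simp: filter_empty_conv)
    then show ?thesis using False by simp
  qed (use Cons in auto)
qed simp

lemma sum_list_diff_eq: "\<forall>x\<in>set xs. t \<le> x \<Longrightarrow> (\<Sum>x\<leftarrow>xs. x - t) + length xs * t = sum_list (xs::nat list)"
  by (induction xs) auto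

lemma sum_take_eq_excess:
  assumes "sorted_wrt (\<ge>) ps"
  obtains t where "sum_list (take k ps) = (\<Sum>p\<leftarrow>ps. p - t) + k * (t::nat)"
proof (cases "k < length ps")
  case True
  let ?t = "ps ! k"
  have ge: "\<forall>p\<in>set (take k ps). ?t \<le> p"
    using assms True by (auto simp: in_set_conv_nth sorted_wrt_iff_nth_less)
  have "ps ! i \<le> ?t" if "k \<le> i" "i < length ps" for i
    using assms that by (cases "k = i") (auto simp: sorted_wrt_iff_nth_less)
  then have "\<forall>p\<in>set (drop k ps). p \<le> ?t"
    by (auto simp: in_set_conv_nth)
  then have "(\<Sum>p\<leftarrow>drop k ps. p - ?t) = 0" by simp
  moreover have "(\<Sum>p\<leftarrow>ps. p - ?t) = (\<Sum>p\<leftarrow>take k ps. p - ?t) + (\<Sum>p\<leftarrow>drop k ps. p - ?t)"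
    by (metis append_take_drop_id map_append sum_list_append)
  moreover have "(\<Sum>p\<leftarrow>take k ps. p - ?t) + k * ?t = sum_list (take k ps)"
    using sum_list_diff_eq[OF ge] True by simp
  ultimately show ?thesis using that[of ?t] by linarith
next
  case False
  then show ?thesis using that[of 0] by simp
qed

text \<open>
  In both directions the bound \<open>sum_take_le_excess\<close> is used for one list, with \<open>k\<close> and \<open>t\<close> chosen
  such that it is an equality for the other one.
\<close>
lemma dominates_iff_excess:
  assumes "sorted_wrt (\<ge>) ps" "sorted_wrt (\<ge>) qs"
  shows "dominates ps qs \<longleftrightarrow> (\<forall>t. (\<Sum>q\<leftarrow>qs. q - t) \<le> (\<Sum>p\<leftarrow>ps. p - t))"
proof
  assume dom: "dominates ps qs"
  show "\<forall>t. (\<Sum>q\<leftarrow>qs. q - t) \<le> (\<Sum>p\<leftarrow>ps. p - t)"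
  proof
    fix t
    let ?k = "length (filter (\<lambda>q. t < q) qs)"
    have "(\<Sum>q\<leftarrow>qs. q - t) + ?k * t = sum_list (take ?k qs)"
      by (rule excess_eq_sum_take[OF assms(2), symmetric])
    also have "\<dots> \<le> sum_list (take ?k ps)"
      using dom unfolding dominates_def by (cases "?k = 0") (simp, metis Suc_eq_plus1 Suc_leI add_0 neq0_conv)
    also have "\<dots> \<le> (\<Sum>p\<leftarrow>ps. p - t) + ?k * t"
      by (rule sum_take_le_excess)
    finally show "(\<Sum>q\<leftarrow>qs. q - t) \<le> (\<Sum>p\<leftarrow>ps. p - t)" by simp
  qed
next
  assume le: "\<forall>t. (\<Sum>q\<leftarrow>qs. q - t) \<le> (\<Sum>p\<leftarrow>ps. p - t)"
  show "dominates ps qs"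
    unfolding dominates_def
  proof (intro allI impI)
    fix k :: nat
    obtain t where t: "sum_list (take k ps) = (\<Sum>p\<leftarrow>ps. p - t) + k * t"
      using sum_take_eq_excess[OF assms(1)] .
    show "sum_list (take k qs) \<le> sum_list (take k ps)"
      using sum_take_le_excess[of k qs t] le t by (metis add_le_cancel_right order_trans)
  qed
qed

definition majorizes :: "expo \<Rightarrow> expo \<Rightarrow> bool" where
  "majorizes \<alpha> \<beta> \<longleftrightarrow> total_degree \<alpha> = total_degree \<beta> \<and> (\<forall>t. excess t \<beta> \<le> excess t \<alpha>)"

lemma majorizes_iff_dominates:
  assumes "ps \<in> partitions n" "qs \<in> partitions n" "exponents \<alpha> = mset ps" "exponents \<beta> = mset qs"
  shows "majorizes \<alpha> \<beta> \<longleftrightarrow> dominates ps qs"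
proof -
  have "total_degree \<alpha> = n" "total_degree \<beta> = n"
    using assms excess_list[of _ _ 0] by (auto simp: partitions_def simp flip: excess_0)
  then show ?thesis
    using assms dominates_iff_excess[of ps qs]
    by (simp add: majorizes_def excess_list partitions_def)
qed

section \<open>Strong niceness as monotonicity on exponent vectors\<close>

lemma coeff_eq_monomial_coeff:
  assumes "homogeneous_symmetric n f" "ps \<in> partitions n" "exponents \<alpha> = mset ps"
  shows "f \<alpha> = monomial_coeff n f ps"
proof -
  have "f \<alpha> = f (Poly_Mapping.nth ps)"
    using assms exponents_nth[OF assms(2)]
    by (intro symmetric_exponents) (auto simp: homogeneous_symmetric_def)
  then show ?thesis
    using monomial_expansion_nth[OF monomial_coeff_expansion[OF assms(1)] assms(2)] by simp
qed

text \<open>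
  Vectors whose degree differs from \<open>n\<close> have coefficient zero, and majorization preserves the
  degree, so a condition on all exponent vectors says the same as one on partitions of \<open>n\<close>.
\<close>
lemma strongly_nice_iff_majorizes:
  "strongly_nice n f \<longleftrightarrow>
     homogeneous_symmetric n f \<and> (\<forall>\<alpha> \<beta>. majorizes \<alpha> \<beta> \<longrightarrow> f \<alpha> \<le> f \<beta>)"
proof (cases "homogeneous_symmetric n f")
  case hs: True
  show ?thesis
  proof (intro iffI conjI allI impI hs)
    fix \<alpha> \<beta>
    assume nice: "strongly_nice n f" and maj: "majorizes \<alpha> \<beta>"
    then have deg: "total_degree \<beta> = total_degree \<alpha>" by (simp add: majorizes_def)
    show "f \<alpha> \<le> f \<beta>"
    proof (cases "total_degree \<alpha> = n")
      case True
      obtain ps where ps: "ps \<in> partitions n" "exponents \<alpha> = mset ps"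
        using partition_exists[of \<alpha>] True by metis
      obtain qs where qs: "qs \<in> partitions n" "exponents \<beta> = mset qs"
        using partition_exists[of \<beta>] True deg by metis
      have "dominates ps qs"
        using maj majorizes_iff_dominates ps qs by blast
      then show ?thesis
        using nice ps qs coeff_eq_monomial_coeff[OF hs] by (auto simp: strongly_nice_def)
    next
      case False
      then have "f \<alpha> = 0" "f \<beta> = 0"
        using hs deg by (auto simp: homogeneous_symmetric_def homogeneous_def)
      then show ?thesis by simp
    qed
  next
    assume *: "homogeneous_symmetric n f \<and> (\<forall>\<alpha> \<beta>. majorizes \<alpha> \<beta> \<longrightarrow> f \<alpha> \<le> f \<beta>)"
    show "strongly_nice n f"
      unfolding strongly_nice_def
    proof (intro conjI hs ballI impI)
      fix ps qs
      assume ps: "ps \<in> partitions n" and qs: "qs \<in> partitions n" and dom: "dominates ps qs"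
      have "majorizes (Poly_Mapping.nth ps) (Poly_Mapping.nth qs)"
        using majorizes_iff_dominates[OF ps qs] exponents_nth ps qs dom by blast
      then show "monomial_coeff n f ps \<le> monomial_coeff n f qs"
        using * coeff_eq_monomial_coeff[OF hs ps exponents_nth[OF ps]]
          coeff_eq_monomial_coeff[OF hs qs exponents_nth[OF qs]] by metis
    qed
  qed
qed (simp add: strongly_nice_def)

lemma coeff_nonneg:
  assumes "homogeneous_symmetric n f" "\<forall>ps\<in>partitions n. 0 \<le> monomial_coeff n f ps"
  shows "0 \<le> f \<alpha>"
proof (cases "total_degree \<alpha> = n")
  case True
  then obtain ps where "ps \<in> partitions n" "exponents \<alpha> = mset ps"
    using partition_exists[of \<alpha>] by metis
  then show ?thesis using assms coeff_eq_monomial_coeff by metis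
next
  case False
  then have "f \<alpha> = 0" using assms(1) by (auto simp: homogeneous_symmetric_def homogeneous_def)
  then show ?thesis by simp
qed

section \<open>Unit transfers generate majorization\<close>

lemma excess_add_single:
  "excess t (\<delta> + Poly_Mapping.single i 1)
     = excess t \<delta> + (if t \<le> Poly_Mapping.lookup \<delta> i then 1 else 0)"
proof -
  let ?A = "insert i (Poly_Mapping.keys \<delta>)"
  have "Poly_Mapping.keys (\<delta> + Poly_Mapping.single i 1) \<subseteq> ?A"
    by (auto simp: in_keys_iff lookup_add lookup_single when_def split: if_splits)
  then have "excess t (\<delta> + Poly_Mapping.single i 1)
      = (\<Sum>k\<in>?A. Poly_Mapping.lookup (\<delta> + Poly_Mapping.single i 1) k - t)"
    by (intro excess_superset) auto
  also have "\<dots> = (\<Sum>k\<in>?A. (Poly_Mapping.lookup \<delta> k - t)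
      + (if k = i then if t \<le> Poly_Mapping.lookup \<delta> i then 1 else 0 else 0))"
    by (intro sum.cong) (auto simp: lookup_add lookup_single when_def)
  also have "\<dots> = excess t \<delta> + (if t \<le> Poly_Mapping.lookup \<delta> i then 1 else 0)"
    by (subst excess_superset[of ?A]) (auto simp: sum.distrib)
  finally show ?thesis .
qed

lemma count_exponents:
  "count (exponents \<alpha>) x = card {i \<in> Poly_Mapping.keys \<alpha>. Poly_Mapping.lookup \<alpha> i = x}"
  unfolding exponents_def by (simp add: count_image_mset_eq_card_vimage)

text \<open>
  The function \<open>t \<mapsto> max(x - t, 0)\<close> is piecewise linear with its only kink at \<open>t = x\<close>, so the second
  difference at \<open>t + 1\<close> receives a contribution of one from each exponent \<open>x = t + 1\<close>.
\<close>
lemma excess_second_difference: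
  "excess t \<alpha> + excess (t + 2) \<alpha> = 2 * excess (t + 1) \<alpha> + count (exponents \<alpha>) (t + 1)"
proof -
  let ?l = "Poly_Mapping.lookup \<alpha>" and ?K = "Poly_Mapping.keys \<alpha>"
  have "count (exponents \<alpha>) (t + 1) = (\<Sum>i\<in>?K. if ?l i = t + 1 then 1 else 0)"
    unfolding count_exponents by (simp flip: sum.inter_filter)
  then have "2 * excess (t + 1) \<alpha> + count (exponents \<alpha>) (t + 1)
      = (\<Sum>i\<in>?K. 2 * (?l i - (t + 1)) + (if ?l i = t + 1 then 1 else 0))"
    by (simp add: excess_def sum.distrib sum_distrib_left)
  also have "\<dots> = (\<Sum>i\<in>?K. (?l i - t) + (?l i - (t + 2)))"
    by (intro sum.cong) auto
  finally show ?thesis by (simp add: excess_def sum.distrib)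
qed

lemma exponents_eq_if_excess_eq:
  assumes "\<And>t. excess t \<alpha> = excess t \<beta>"
  shows "exponents \<alpha> = exponents \<beta>"
proof (rule multiset_eqI)
  fix x
  show "count (exponents \<alpha>) x = count (exponents \<beta>) x"
  proof (cases x)
    case 0
    have "count (exponents \<gamma>) 0 = 0" for \<gamma>
      by (auto simp: count_exponents in_keys_iff)
    then show ?thesis using 0 by simp
  next
    case (Suc t)
    show ?thesis
      using excess_second_difference[of t \<alpha>] excess_second_difference[of t \<beta>] assms Suc by simp
  qed
qed

lemma obtain_exponent:
  assumes "0 < count (exponents \<alpha>) x"
  obtains i where "Poly_Mapping.lookup \<alpha> i = x"
  using assms that unfolding count_exponents by (auto simp: card_gt_0_iff)

lemma excess_eq_0: "total_degree \<alpha> \<le> t \<Longrightarrow> excess t \<alpha> = 0"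
  using member_le_sum[of _ "Poly_Mapping.keys \<alpha>" "Poly_Mapping.lookup \<alpha>"]
  by (force simp: excess_def total_degree_def)

text \<open>
  As long as some excess of \<open>\<alpha>\<close> is strictly larger than that of \<open>\<beta>\<close>, take a maximal interval
  \<open>r < t \<le> q\<close> on which this happens. By the second difference, \<open>\<alpha>\<close> has at each end more exponents
  with the adjacent value than \<open>\<beta>\<close>, so the values \<open>q + 1\<close> and \<open>r\<close> occur in \<open>\<alpha>\<close> (for \<open>r = 0\<close> because
  only finitely many exponents are nonzero). Moving a unit
  from the first to the second lowers the excesses by one exactly on that interval, so the result
  still majorizes \<open>\<beta>\<close>. If all excesses agree, then so do the multisets of exponents.
\<close>
lemma mono_on_majorization_if_unit_transfers:
  fixes h :: series
  assumes sym: "symmetric h"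
    and transfer: "\<And>\<delta> i j. Poly_Mapping.lookup \<delta> j < Poly_Mapping.lookup \<delta> i \<Longrightarrow>
      h (\<delta> + Poly_Mapping.single i 1) \<le> h (\<delta> + Poly_Mapping.single j 1)"
  shows "majorizes \<alpha> \<beta> \<Longrightarrow> h \<alpha> \<le> h \<beta>"
proof (induction "\<Sum>t<total_degree \<alpha>. excess t \<alpha>" arbitrary: \<alpha> rule: less_induct)
  case less
  note deg = less.prems[unfolded majorizes_def, THEN conjunct1]
  have le: "excess t \<beta> \<le> excess t \<alpha>" for t
    using less.prems by (simp add: majorizes_def)
  define T where "T = {t. excess t \<beta> < excess t \<alpha>}"
  have eq: "excess t \<alpha> = excess t \<beta>" if "t \<notin> T" for t
    using that le[of t] by (simp add: T_def)
  show ?case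
  proof (cases "T = {}")
    case True
    then have "exponents \<alpha> = exponents \<beta>"
      by (intro exponents_eq_if_excess_eq eq) simp
    then have "h \<alpha> = h \<beta>" by (rule symmetric_exponents[OF sym])
    then show ?thesis by simp
  next
    case False
    have bound: "t < total_degree \<alpha>" if "t \<in> T" for t
    proof (rule ccontr)
      assume "\<not> t < total_degree \<alpha>"
      then have "excess t \<alpha> = 0" by (intro excess_eq_0) simp
      then show False using that by (simp add: T_def)
    qed
    then have finT: "finite T" by (auto intro: finite_subset[of _ "{..<total_degree \<alpha>}"])
    have "0 \<notin> T" using deg by (simp add: T_def excess_0)
    define q where "q = Max T"
    have "q \<in> T" unfolding q_def using finT False by (rule Max_in)
    moreover have "t \<le> q" if "t \<in> T" for t
      unfolding q_def using finT that by (rule Max_ge)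
    ultimately have q: "q \<in> T" "q + 1 \<notin> T" "q + 2 \<notin> T" by force+
    define r where "r = Max {t. t \<le> q \<and> t \<notin> T}"
    have finr: "finite {t. t \<le> q \<and> t \<notin> T}" by simp
    have r: "r \<le> q" "r \<notin> T"
      using Max_in[OF finr] \<open>0 \<notin> T\<close> unfolding r_def by blast+
    have inT: "t \<in> T" if "r < t" "t \<le> q" for t
      using that Max_ge[OF finr, of t] unfolding r_def by fastforce
    have "r < q" using r q(1) by (metis le_neq_implies_less)
    have "0 < count (exponents \<alpha>) (q + 1)"
      using excess_second_difference[of q \<alpha>] excess_second_difference[of q \<beta>]
        eq[OF q(2)] eq[OF q(3)] q(1) unfolding T_def mem_Collect_eq by linarith
    then obtain i where i: "Poly_Mapping.lookup \<alpha> i = q + 1"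
      by (rule obtain_exponent)
    have "\<exists>j. Poly_Mapping.lookup \<alpha> j = r"
    proof (cases r)
      case 0
      have "\<exists>j. j \<notin> Poly_Mapping.keys \<alpha>"
        by (rule ex_new_if_finite) auto
      then show ?thesis using 0 by (simp add: in_keys_iff)
    next
      case (Suc s)
      have "s + 2 \<in> T" using inT \<open>r < q\<close> Suc by simp
      moreover have "excess (s + 1) \<alpha> = excess (s + 1) \<beta>"
        using eq[OF r(2)] Suc by simp
      ultimately have "0 < count (exponents \<alpha>) (s + 1)"
        using excess_second_difference[of s \<alpha>] excess_second_difference[of s \<beta>] le[of s]
        unfolding T_def mem_Collect_eq by linarith
      then show ?thesis using Suc by (metis Suc_eq_plus1 obtain_exponent)
    qed
    then obtain j where j: "Poly_Mapping.lookup \<alpha> j = r" by blast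
    have "i \<noteq> j" using i j r by auto
    define \<delta> where "\<delta> = \<alpha> - Poly_Mapping.single i 1"
    define \<alpha>' where "\<alpha>' = \<delta> + Poly_Mapping.single j 1"
    have \<alpha>: "\<alpha> = \<delta> + Poly_Mapping.single i 1"
      using i unfolding \<delta>_def
      by (intro poly_mapping_eqI) (auto simp: lookup_add lookup_minus lookup_single when_def)
    have \<delta>: "Poly_Mapping.lookup \<delta> i = q" "Poly_Mapping.lookup \<delta> j = r"
      using i j \<open>i \<noteq> j\<close> by (auto simp: \<delta>_def lookup_minus lookup_single)
    have ex: "excess t \<alpha> = excess t \<alpha>' + (if r < t \<and> t \<le> q then 1 else 0)" for t
      using \<open>r < q\<close> unfolding \<alpha>'_def \<alpha> excess_add_single \<delta> by auto
    have deg': "total_degree \<alpha>' = total_degree \<alpha>"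
      using ex[of 0] by (simp flip: excess_0)
    have "excess t \<beta> \<le> excess t \<alpha>'" for t
      using ex[of t] le[of t] inT[of t] by (auto simp: T_def split: if_splits)
    then have "majorizes \<alpha>' \<beta>" using deg deg' by (simp add: majorizes_def)
    moreover have "(\<Sum>t<total_degree \<alpha>'. excess t \<alpha>') < (\<Sum>t<total_degree \<alpha>. excess t \<alpha>)"
      unfolding deg'
    proof (rule sum_strict_mono_ex1)
      show "\<exists>t\<in>{..<total_degree \<alpha>}. excess t \<alpha>' < excess t \<alpha>"
        using ex[of q] \<open>r < q\<close> bound[OF q(1)] by (intro bexI[of _ q]) simp_all
    qed (use ex in auto)
    ultimately have "h \<alpha>' \<le> h \<beta>" using less.hyps by blast
    moreover have "h \<alpha> \<le> h \<alpha>'"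
      unfolding \<alpha>'_def \<alpha> using transfer \<delta> \<open>r < q\<close> by simp
    ultimately show ?thesis by simp
  qed
qed

section \<open>Extension by zero to integer exponents\<close>

definition int_expo :: "expo \<Rightarrow> nat \<Rightarrow> int" where
  "int_expo \<alpha> = (\<lambda>k. int (Poly_Mapping.lookup \<alpha> k))"

definition extend :: "series \<Rightarrow> (nat \<Rightarrow> int) \<Rightarrow> rat" where
  "extend f v = (if v \<in> range int_expo then f (inv int_expo v) else 0)"

lemma inj_int_expo: "inj int_expo"
  by (rule injI) (auto simp: int_expo_def fun_eq_iff intro: poly_mapping_eqI)

lemma extend_int_expo [simp]: "extend f (int_expo \<alpha>) = f \<alpha>"
  by (simp add: extend_def inj_int_expo)

lemma extend_outside: "v \<notin> range int_expo \<Longrightarrow> extend f v = 0"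
  by (simp add: extend_def)

lemma extend_nonneg: "(\<And>\<alpha>. 0 \<le> f \<alpha>) \<Longrightarrow> 0 \<le> extend f v"
  by (simp add: extend_def)

text \<open>
  The vector \<open>w\<close> arises from \<open>v\<close> by a transfer between the coordinates \<open>i\<close> and \<open>j\<close>, of any size,
  that brings the two entries at most as far apart as before. Exchanging the two entries is allowed.
\<close>
definition levels :: "nat \<Rightarrow> nat \<Rightarrow> (nat \<Rightarrow> int) \<Rightarrow> (nat \<Rightarrow> int) \<Rightarrow> bool" where
  "levels i j v w \<longleftrightarrow> (\<forall>k. k \<noteq> i \<longrightarrow> k \<noteq> j \<longrightarrow> w k = v k) \<and> w i + w j = v i + v j \<and>
     max (w i) (w j) \<le> max (v i) (v j)"

lemma majorizes_if_levels:
  assumes "i \<noteq> j" "levels i j (int_expo \<alpha>) (int_expo \<beta>)"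
  shows "majorizes \<alpha> \<beta>"
proof -
  let ?a = "Poly_Mapping.lookup \<alpha>" and ?b = "Poly_Mapping.lookup \<beta>"
  let ?K = "Poly_Mapping.keys \<alpha> \<union> Poly_Mapping.keys \<beta> - {i, j}"
  have eq: "?b k = ?a k" if "k \<noteq> i" "k \<noteq> j" for k
    using assms that by (auto simp: levels_def int_expo_def)
  have sum: "?b i + ?b j = ?a i + ?a j" "max (?b i) (?b j) \<le> max (?a i) (?a j)"
    using assms by (auto simp: levels_def int_expo_def)
  have split: "excess t \<gamma> = (Poly_Mapping.lookup \<gamma> i - t) + (Poly_Mapping.lookup \<gamma> j - t)
      + (\<Sum>k\<in>?K. Poly_Mapping.lookup \<gamma> k - t)"
    if "Poly_Mapping.keys \<gamma> \<subseteq> Poly_Mapping.keys \<alpha> \<union> Poly_Mapping.keys \<beta>" for \<gamma> t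
    using that \<open>i \<noteq> j\<close> by (subst excess_superset[of "insert i (insert j ?K)"]) auto
  have rest: "(\<Sum>k\<in>?K. ?b k - t) = (\<Sum>k\<in>?K. ?a k - t)" for t
    by (intro sum.cong) (auto simp: eq)
  have "excess t \<beta> \<le> excess t \<alpha>" for t
    using sum by (simp add: split rest) linarith
  moreover have "excess 0 \<alpha> = excess 0 \<beta>"
    using sum rest[of 0] by (simp add: split)
  ultimately show ?thesis by (simp add: majorizes_def excess_0)
qed

text \<open>
  If \<open>v\<close> is not an exponent vector, its value is zero, hence at most the value of \<open>w\<close>. If it is one,
  then \<open>w\<close> has no negative entry either, because its smaller entry at \<open>i\<close> or \<open>j\<close> is at least that of \<open>v\<close>.
\<close>
lemma extend_mono_levels:
  assumes nonneg: "\<And>\<alpha>. 0 \<le> f \<alpha>" and mono: "\<And>\<alpha> \<beta>. majorizes \<alpha> \<beta> \<Longrightarrow> f \<alpha> \<le> f \<beta>"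
    and "i \<noteq> j" "levels i j v w"
  shows "extend f v \<le> extend f w"
proof (cases "v \<in> range int_expo")
  case False
  then show ?thesis using extend_nonneg[OF nonneg] by (simp add: extend_outside)
next
  case True
  then obtain \<alpha> where \<alpha>: "v = int_expo \<alpha>" by blast
  define \<beta> where
    "\<beta> = Poly_Mapping.update i (nat (w i)) (Poly_Mapping.update j (nat (w j)) \<alpha>)"
  have "0 \<le> v i" "0 \<le> v j" by (simp_all add: \<alpha> int_expo_def)
  then have "0 \<le> w i" "0 \<le> w j"
    using assms(4) by (auto simp: levels_def)
  then have w: "w = int_expo \<beta>"
    using assms(4) by (auto simp: \<beta>_def levels_def int_expo_def lookup_update \<alpha> fun_eq_iff)
  show ?thesis
    using mono majorizes_if_levels assms(3,4) by (simp add: \<alpha> w)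
qed

section \<open>The coefficients of a product\<close>

lemma product_support:
  "{v. extend f v * extend g (\<lambda>k. int_expo \<gamma> k - v k) \<noteq> 0}
     \<subseteq> (\<lambda>(\<alpha>, \<beta>). int_expo \<alpha>) ` {(\<alpha>, \<beta>). \<alpha> + \<beta> = \<gamma>}"
proof
  fix v assume "v \<in> {v. extend f v * extend g (\<lambda>k. int_expo \<gamma> k - v k) \<noteq> 0}"
  then have "v \<in> range int_expo" "(\<lambda>k. int_expo \<gamma> k - v k) \<in> range int_expo"
    using extend_outside by force+
  then obtain \<alpha> \<beta> where v: "v = int_expo \<alpha>" and \<beta>: "(\<lambda>k. int_expo \<gamma> k - v k) = int_expo \<beta>"
    by blast
  have "\<alpha> + \<beta> = \<gamma>"
  proof (rule poly_mapping_eqI)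
    fix k show "Poly_Mapping.lookup (\<alpha> + \<beta>) k = Poly_Mapping.lookup \<gamma> k"
      using fun_cong[OF \<beta>, of k] by (simp add: v int_expo_def lookup_add)
  qed
  then show "v \<in> (\<lambda>(\<alpha>, \<beta>). int_expo \<alpha>) ` {(\<alpha>, \<beta>). \<alpha> + \<beta> = \<gamma>}" using v by force
qed

lemma finite_product_support:
  "finite {v. extend f v * extend g (\<lambda>k. int_expo \<gamma> k - v k) \<noteq> 0}"
  using finite_decompositions by (blast intro: finite_subset[OF product_support])

text \<open>
  Over all integer vectors, translations and exchanges of coordinates are bijections of
  the index set, so the sum can be reindexed by them without regard to its range.
\<close>
lemma series_mult_eq_Sum_any:
  "(f \<otimes> g) \<gamma> = Sum_any (\<lambda>v. extend f v * extend g (\<lambda>k. int_expo \<gamma> k - v k))"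
proof -
  let ?h = "\<lambda>v. extend f v * extend g (\<lambda>k. int_expo \<gamma> k - v k)"
  let ?D = "{(\<alpha>, \<beta>). \<alpha> + \<beta> = \<gamma>}"
  have inj: "inj_on (\<lambda>(\<alpha>, \<beta>). int_expo \<alpha>) ?D"
    by (rule inj_onI) (auto dest!: injD[OF inj_int_expo])
  have "Sum_any ?h = sum ?h ((\<lambda>(\<alpha>, \<beta>). int_expo \<alpha>) ` ?D)"
    using finite_decompositions[of \<gamma>] product_support
    by (intro Sum_any.expand_superset) auto
  also have "\<dots> = (\<Sum>(\<alpha>, \<beta>)\<in>?D. ?h (int_expo \<alpha>))"
    by (subst sum.reindex[OF inj]) (simp add: comp_def case_prod_unfold)
  also have "\<dots> = (\<Sum>(\<alpha>, \<beta>)\<in>?D. f \<alpha> * g \<beta>)"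
  proof (intro sum.cong refl, clarify)
    fix \<alpha> \<beta> assume "\<gamma> = \<alpha> + \<beta>"
    have "(\<lambda>k. int_expo (\<alpha> + \<beta>) k - int_expo \<alpha> k) = int_expo \<beta>"
      by (simp add: int_expo_def lookup_add fun_eq_iff)
    then show "extend f (int_expo \<alpha>) * extend g (\<lambda>k. int_expo (\<alpha> + \<beta>) k - int_expo \<alpha> k) = f \<alpha> * g \<beta>"
      by simp
  qed
  finally show ?thesis by (simp add: series_mult_def)
qed

lemma Sum_any_bij:
  assumes "bij \<phi>"
  shows "Sum_any (\<lambda>v. h (\<phi> v)) = Sum_any h"
    and "finite {v. h v \<noteq> 0} \<Longrightarrow> finite {v. h (\<phi> v) \<noteq> 0}"
proof -
  show "Sum_any (\<lambda>v. h (\<phi> v)) = Sum_any h"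
    using assms by (intro Sum_any.reindex_cong[symmetric]) (auto simp: bij_def comp_def)
  show "finite {v. h v \<noteq> 0} \<Longrightarrow> finite {v. h (\<phi> v) \<noteq> 0}"
    using finite_vimageI[of "{v. h v \<noteq> 0}" \<phi>] assms by (simp add: bij_def vimage_def)
qed

lemma Sum_any_mono_rat:
  fixes p q :: "'c \<Rightarrow> rat"
  assumes "finite {v. p v \<noteq> 0}" "finite {v. q v \<noteq> 0}" "\<And>v. p v \<le> q v"
  shows "Sum_any p \<le> Sum_any q"
proof -
  let ?A = "{v. p v \<noteq> 0} \<union> {v. q v \<noteq> 0}"
  have "Sum_any p = sum p ?A" "Sum_any q = sum q ?A"
    using assms by (auto intro!: Sum_any.expand_superset)
  then show ?thesis using assms(3) by (simp add: sum_mono)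
qed

text \<open>
  The symmetrisation argument: each of the two coefficients is written as a sum over \<open>v\<close> in two ways
  that differ by exchanging the coordinates \<open>i\<close> and \<open>j\<close> of \<open>v\<close>. Twice the difference of the
  coefficients is then a sum of products of two factors of equal sign.
\<close>
lemma series_mult_unit_transfer:
  assumes f: "\<And>\<alpha>. 0 \<le> f \<alpha>" "\<And>\<alpha> \<beta>. majorizes \<alpha> \<beta> \<Longrightarrow> f \<alpha> \<le> f \<beta>"
    and g: "\<And>\<alpha>. 0 \<le> g \<alpha>" "\<And>\<alpha> \<beta>. majorizes \<alpha> \<beta> \<Longrightarrow> g \<alpha> \<le> g \<beta>"
    and lt: "Poly_Mapping.lookup \<delta> j < Poly_Mapping.lookup \<delta> i"
  shows "(f \<otimes> g) (\<delta> + Poly_Mapping.single i 1) \<le> (f \<otimes> g) (\<delta> + Poly_Mapping.single j 1)"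
proof -
  have ij: "i \<noteq> j" using lt by auto
  define up where "up l v = v(l := v l + 1)" for l :: nat and v :: "nat \<Rightarrow> int"
  define swap where "swap v = v \<circ> transpose i j" for v :: "nat \<Rightarrow> int"
  define rest where "rest v = (\<lambda>k. int_expo \<delta> k - v k)" for v
  define u where "u l v = extend f (up l v) * extend g (rest v)" for l v
  define u' where "u' l v = extend f (up l v) * extend g (rest (swap v))" for l v
  have bij_up: "bij (up l)" for l
    by (rule bij_betw_byWitness[where f' = "\<lambda>v. v(l := v l - 1)"]) (auto simp: up_def)
  have bij_swap: "bij swap"
    by (rule bij_betw_byWitness[where f' = swap]) (auto simp: swap_def fun_eq_iff)
  have shift: "(\<lambda>k. int_expo (\<delta> + Poly_Mapping.single l 1) k - up l v k) = rest v" for l v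
    by (auto simp: rest_def up_def int_expo_def lookup_add lookup_single when_def)
  have u: "Sum_any (u l) = (f \<otimes> g) (\<delta> + Poly_Mapping.single l 1)" "finite {v. u l v \<noteq> 0}" for l
  proof -
    define h where "h w = extend f w * extend g (\<lambda>k. int_expo (\<delta> + Poly_Mapping.single l 1) k - w k)" for w
    have "u l = (\<lambda>v. h (up l v))" by (rule ext) (simp only: u_def h_def shift)
    then show "Sum_any (u l) = (f \<otimes> g) (\<delta> + Poly_Mapping.single l 1)" "finite {v. u l v \<noteq> 0}"
      using Sum_any_bij[OF bij_up[of l], of h]
        finite_product_support[of f g "\<delta> + Poly_Mapping.single l 1", folded h_def]
      by (simp_all only: series_mult_eq_Sum_any h_def[symmetric])
  qed
  \<comment> \<open>An exchange of two entries levels in both directions.\<close>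
  have sym: "extend f (swap v) = extend f v" for v
    by (intro order.antisym extend_mono_levels[OF f ij])
      (auto simp: levels_def swap_def transpose_def)
  have "up j (swap v) = swap (up i v)" "up i (swap v) = swap (up j v)" for v
    using ij by (auto simp: up_def swap_def transpose_def fun_eq_iff)
  then have "u' i = (\<lambda>v. u j (swap v))" "u' j = (\<lambda>v. u i (swap v))"
    by (auto simp: u_def u'_def sym)
  then have u': "Sum_any (u' i) = Sum_any (u j)" "finite {v. u' i v \<noteq> 0}"
      "Sum_any (u' j) = Sum_any (u i)" "finite {v. u' j v \<noteq> 0}"
    using Sum_any_bij[OF bij_swap, of "u i"] Sum_any_bij[OF bij_swap, of "u j"] u(2)
    by (simp_all only:)
  have le: "u i v + u' j v \<le> u j v + u' i v" for v
  proof -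
    have "0 \<le> (extend f (up j v) - extend f (up i v)) *
        (extend g (rest v) - extend g (rest (swap v)))"
      \<comment> \<open>If \<open>v\<^sub>j \<le> v\<^sub>i\<close>, a unit added at \<open>i\<close> leaves the entries of \<open>v\<close> at least as far apart as
        one added at \<open>j\<close>; as \<open>\<delta>\<^sub>j < \<delta>\<^sub>i\<close>, subtracting the larger entry from \<open>\<delta>\<^sub>j\<close> leaves the entries
        of the remainder at least as far apart as subtracting it from \<open>\<delta>\<^sub>i\<close>.\<close>
    proof (cases "v j \<le> v i")
      case True
      then have "levels i j (up i v) (up j v)" "levels i j (rest (swap v)) (rest v)"
        using ij lt by (auto simp: levels_def up_def rest_def swap_def int_expo_def)
      then show ?thesis
        using extend_mono_levels[OF f ij] extend_mono_levels[OF g ij]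
        by (intro mult_nonneg_nonneg) simp_all
    next
      case False
      then have "levels i j (up j v) (up i v)" "levels i j (rest v) (rest (swap v))"
        using ij lt by (auto simp: levels_def up_def rest_def swap_def int_expo_def)
      then show ?thesis
        using extend_mono_levels[OF f ij] extend_mono_levels[OF g ij]
        by (intro mult_nonpos_nonpos) simp_all
    qed
    then show ?thesis by (simp add: u_def u'_def algebra_simps)
  qed
  have fin: "finite {v. a v + b v \<noteq> 0}" if "finite {v. a v \<noteq> 0}" "finite {v. b v \<noteq> 0}"
    for a b :: "(nat \<Rightarrow> int) \<Rightarrow> rat"
    by (rule finite_subset[OF _ finite_UnI[OF that]]) auto
  have "Sum_any (\<lambda>v. u i v + u' j v) \<le> Sum_any (\<lambda>v. u j v + u' i v)"
    using le by (intro Sum_any_mono_rat fin u(2) u')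
  then have "2 * Sum_any (u i) \<le> 2 * Sum_any (u j)"
    using u(2) u' by (simp add: Sum_any.distrib)
  then show ?thesis by (simp add: u(1))
qed

lemma total_degree_add: "total_degree (\<alpha> + \<beta>) = total_degree \<alpha> + total_degree \<beta>"
proof -
  let ?A = "Poly_Mapping.keys \<alpha> \<union> Poly_Mapping.keys \<beta>"
  have "excess 0 (\<alpha> + \<beta>) = (\<Sum>i\<in>?A. Poly_Mapping.lookup (\<alpha> + \<beta>) i - 0)"
    using keys_add[of \<alpha> \<beta>] by (intro excess_superset) auto
  then show ?thesis
    using excess_superset[of ?A \<alpha> 0] excess_superset[of ?A \<beta> 0]
    by (simp add: lookup_add sum.distrib flip: excess_0)
qed

lemma homogeneous_symmetric_mult:
  assumes "homogeneous_symmetric d f" "homogeneous_symmetric e g"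
  shows "homogeneous_symmetric (d + e) (f \<otimes> g)"
proof -
  have "total_degree \<gamma> = d + e" if nz: "(f \<otimes> g) \<gamma> \<noteq> 0" for \<gamma>
  proof -
    obtain p where p: "p \<in> {(\<alpha>, \<beta>). \<alpha> + \<beta> = \<gamma>}" "(case p of (\<alpha>, \<beta>) \<Rightarrow> f \<alpha> * g \<beta>) \<noteq> 0"
      by (rule sum.not_neutral_contains_not_neutral[OF nz[unfolded series_mult_def]])
    then obtain \<alpha> \<beta> where "\<alpha> + \<beta> = \<gamma>" "f \<alpha> \<noteq> 0" "g \<beta> \<noteq> 0"
      by (cases p) simp
    then show ?thesis
      using assms by (auto simp: homogeneous_symmetric_def homogeneous_def total_degree_add)
  qed
  moreover have "(f \<otimes> g) (Poly_Mapping.map_key \<pi> \<gamma>) = (f \<otimes> g) \<gamma>" if \<pi>: "bij \<pi>" for \<pi> \<gamma>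
  proof -
    let ?m = "Poly_Mapping.map_key \<pi>" and ?w = "Poly_Mapping.map_key (inv \<pi>)"
    have inj: "inj \<pi>" "inj (inv \<pi>)" using \<pi> bij_imp_bij_inv[OF \<pi>] by (auto simp: bij_def)
    have inverse: "?m (?w \<alpha>) = \<alpha>" "?w (?m \<alpha>) = \<alpha>" for \<alpha> :: expo
      using \<pi> inj by (auto intro!: poly_mapping_eqI simp: map_key.rep_eq bij_def surj_f_inv_f)
    have fg: "f (?m \<alpha>) = f \<alpha>" "g (?m \<alpha>) = g \<alpha>" for \<alpha>
      using assms \<pi> by (auto simp: homogeneous_symmetric_def symmetric_def)
    show ?thesis
      unfolding series_mult_def
    proof (rule sum.reindex_bij_witness[where i = "\<lambda>(\<alpha>, \<beta>). (?m \<alpha>, ?m \<beta>)"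
          and j = "\<lambda>(\<alpha>, \<beta>). (?w \<alpha>, ?w \<beta>)"], goal_cases)
      case (2 a)
      then show ?case using inj by (auto simp: inverse map_key_plus[symmetric])
    next
      case (4 b)
      then show ?case using inj by (auto simp: map_key_plus)
    next
      case (5 a)
      then show ?case using fg[of "?w (fst a)"] fg[of "?w (snd a)"] by (auto simp: inverse)
    qed (auto simp: inverse)
  qed
  ultimately show ?thesis
    by (auto simp: homogeneous_symmetric_def homogeneous_def symmetric_def)
qed

lemma strongly_nice_mult:
  assumes f: "strongly_nice d f" "\<And>\<alpha>. 0 \<le> f \<alpha>" and g: "strongly_nice e g" "\<And>\<alpha>. 0 \<le> g \<alpha>"
  shows "strongly_nice (d + e) (f \<otimes> g)"
proof -
  have hs: "homogeneous_symmetric (d + e) (f \<otimes> g)"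
    using f g by (intro homogeneous_symmetric_mult) (auto simp: strongly_nice_def)
  have mono: "f \<alpha> \<le> f \<beta>" "g \<alpha> \<le> g \<beta>" if "majorizes \<alpha> \<beta>" for \<alpha> \<beta>
    using f(1) g(1) that by (simp_all add: strongly_nice_iff_majorizes)
  have "symmetric (f \<otimes> g)" using hs by (simp add: homogeneous_symmetric_def)
  then have "(f \<otimes> g) \<alpha> \<le> (f \<otimes> g) \<beta>" if "majorizes \<alpha> \<beta>" for \<alpha> \<beta>
    using series_mult_unit_transfer[OF f(2) mono(1) g(2) mono(2)] that
    by (rule mono_on_majorization_if_unit_transfers)
  then show ?thesis using hs by (simp add: strongly_nice_iff_majorizes)
qed

section \<open>Disjoint unions of graphs\<close>

lemma disjoint_union_edges_iff [simp]:
  "{Inl u, Inl v} \<in> disjoint_union_edges E F \<longleftrightarrow> {u, v} \<in> E"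
  "{Inr x, Inr y} \<in> disjoint_union_edges E F \<longleftrightarrow> {x, y} \<in> F"
  "{Inl u, Inr y} \<notin> disjoint_union_edges E F"
  "{Inr y, Inl u} \<notin> disjoint_union_edges E F"
proof -
  have l: "{Inl u, Inl v} = Inl ` e \<longleftrightarrow> {u, v} = e" for u v and e :: "'a set"
    using inj_image_eq_iff[OF inj_Inl, of "{u, v}" e] by simp
  have r: "{Inr x, Inr y} = Inr ` e \<longleftrightarrow> {x, y} = e" for x y and e :: "'b set"
    using inj_image_eq_iff[OF inj_Inr, of "{x, y}" e] by simp
  show "{Inl u, Inl v} \<in> disjoint_union_edges E F \<longleftrightarrow> {u, v} \<in> E"
    unfolding disjoint_union_edges_def image_iff Un_iff l by auto
  show "{Inr x, Inr y} \<in> disjoint_union_edges E F \<longleftrightarrow> {x, y} \<in> F"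
    unfolding disjoint_union_edges_def image_iff Un_iff r by auto
  show "{Inl u, Inr y} \<notin> disjoint_union_edges E F" "{Inr y, Inl u} \<notin> disjoint_union_edges E F"
    unfolding disjoint_union_edges_def by auto
qed

text \<open>
  No edge joins the two parts, so a proper coloring of the union is an arbitrary pair of
  proper colorings of the parts, and its monomial is the product of their monomials.
\<close>
lemma chromatic_sym_disjoint_union:
  assumes V: "finite V" and W: "finite W"
  shows "chromatic_sym (V <+> W) (disjoint_union_edges E F) = chromatic_sym V E \<otimes> chromatic_sym W F"
proof
  fix \<gamma> :: expo
  let ?D = "{(\<alpha>, \<beta>). \<alpha> + \<beta> = \<gamma>}"
  let ?C = "\<lambda>\<alpha>. {\<kappa> \<in> proper_colorings V E. coloring_expo V \<kappa> = \<alpha>}"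
  let ?C' = "\<lambda>\<beta>. {\<kappa> \<in> proper_colorings W F. coloring_expo W \<kappa> = \<beta>}"
  let ?U = "{\<kappa> \<in> proper_colorings (V <+> W) (disjoint_union_edges E F).
      coloring_expo (V <+> W) \<kappa> = \<gamma>}"
  let ?S = "SIGMA p:?D. ?C (fst p) \<times> ?C' (snd p)"
  let ?r = "\<lambda>\<kappa>. restrict (\<kappa> \<circ> Inl) V" and ?r' = "\<lambda>\<kappa>. restrict (\<kappa> \<circ> Inr) W"
  let ?split = "\<lambda>\<kappa>. ((coloring_expo V (?r \<kappa>), coloring_expo W (?r' \<kappa>)), (?r \<kappa>, ?r' \<kappa>))"
  let ?glue = "\<lambda>(_, \<kappa>1, \<kappa>2). restrict (case_sum \<kappa>1 \<kappa>2) (V <+> W)"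
  have expo: "coloring_expo (V <+> W) \<kappa> = coloring_expo V (?r \<kappa>) + coloring_expo W (?r' \<kappa>)" for \<kappa>
    unfolding coloring_expo_def using V W by (simp add: sum.Plus)
  have restrict_glue: "?r (?glue (p, \<kappa>1, \<kappa>2)) = restrict \<kappa>1 V"
      "?r' (?glue (p, \<kappa>1, \<kappa>2)) = restrict \<kappa>2 W" for p :: "expo \<times> expo" and \<kappa>1 \<kappa>2
    by (auto simp: restrict_def fun_eq_iff)
  have restrict_id: "restrict \<kappa> V = \<kappa>" if "\<kappa> \<in> proper_colorings V E" for \<kappa>
    using that by (auto simp: proper_colorings_def PiE_def extensional_restrict)
  have restrict_id': "restrict \<kappa> W = \<kappa>" if "\<kappa> \<in> proper_colorings W F" for \<kappa>
    using that by (auto simp: proper_colorings_def PiE_def extensional_restrict)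
  have "bij_betw ?split ?U ?S"
  proof (rule bij_betw_byWitness[where f' = ?glue])
    show "\<forall>\<kappa>\<in>?U. ?glue (?split \<kappa>) = \<kappa>"
    proof
      fix \<kappa> assume "\<kappa> \<in> ?U"
      then have "\<kappa> \<in> extensional (V <+> W)" by (auto simp: proper_colorings_def PiE_def)
      then show "?glue (?split \<kappa>) = \<kappa>"
        by (auto simp: restrict_def fun_eq_iff extensional_def split: sum.split)
    qed
    show "\<forall>s\<in>?S. ?split (?glue s) = s"
    proof
      fix s assume "s \<in> ?S"
      then obtain \<alpha> \<beta> \<kappa>1 \<kappa>2 where s: "s = ((\<alpha>, \<beta>), \<kappa>1, \<kappa>2)"
        and k: "\<kappa>1 \<in> ?C \<alpha>" "\<kappa>2 \<in> ?C' \<beta>"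
        by auto
      show "?split (?glue s) = s"
        unfolding s restrict_glue using k restrict_id restrict_id' by simp
    qed
    have ball_Plus: "(\<forall>x\<in>V <+> W. P x) \<longleftrightarrow> (\<forall>u\<in>V. P (Inl u)) \<and> (\<forall>w\<in>W. P (Inr w))" for P
      by auto
    show "?split ` ?U \<subseteq> ?S"
      unfolding proper_colorings_def ball_Plus by (auto simp: expo)
    show "?glue ` ?S \<subseteq> ?U"
    proof (rule image_subsetI)
      fix s assume "s \<in> ?S"
      then obtain \<alpha> \<beta> \<kappa>1 \<kappa>2 where s: "s = ((\<alpha>, \<beta>), \<kappa>1, \<kappa>2)" and \<gamma>: "\<alpha> + \<beta> = \<gamma>"
        and k: "\<kappa>1 \<in> ?C \<alpha>" "\<kappa>2 \<in> ?C' \<beta>"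
        by auto
      have "coloring_expo (V <+> W) (?glue s) = \<gamma>"
        unfolding expo s restrict_glue using k \<gamma> restrict_id restrict_id' by simp
      moreover have "?glue s \<in> proper_colorings (V <+> W) (disjoint_union_edges E F)"
        using k by (auto simp: s proper_colorings_def)
      ultimately show "?glue s \<in> ?U" by simp
    qed
  qed
  then have "card ?U = card ?S" by (rule bij_betw_same_card)
  also have "\<dots> = (\<Sum>p\<in>?D. card (?C (fst p) \<times> ?C' (snd p)))"
    using finite_decompositions finite_colorings[OF V] finite_colorings[OF W]
    by (intro card_SigmaI) auto
  also have "\<dots> = (\<Sum>(\<alpha>, \<beta>)\<in>?D. card (?C \<alpha>) * card (?C' \<beta>))"
    by (simp add: card_cartesian_product case_prod_unfold)
  finally show "chromatic_sym (V <+> W) (disjoint_union_edges E F) \<gamma>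
      = (chromatic_sym V E \<otimes> chromatic_sym W F) \<gamma>"
    unfolding chromatic_sym_def series_mult_def by (simp add: case_prod_unfold)
qed

theorem theorem4p1:
  fixes f g :: series and d e :: nat
    and V :: "'a set" and E :: "'a set set" and W :: "'b set" and F :: "'b set set"
  shows
    "(homogeneous_symmetric d f \<and> homogeneous_symmetric e g \<and>
      (\<forall>ps\<in>partitions d. 0 \<le> monomial_coeff d f ps) \<and>
      (\<forall>ps\<in>partitions e. 0 \<le> monomial_coeff e g ps) \<and>
      strongly_nice d f \<and> strongly_nice e g
        \<longrightarrow> strongly_nice (d + e) (f \<otimes> g)) \<and>
     (simple_graph V E \<and> simple_graph W F \<and>
      strongly_nice_graph V E \<and> strongly_nice_graph W F
        \<longrightarrow> strongly_nice_graph (V <+> W) (disjoint_union_edges E F))"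
proof (intro conjI impI)
  assume "homogeneous_symmetric d f \<and> homogeneous_symmetric e g \<and>
      (\<forall>ps\<in>partitions d. 0 \<le> monomial_coeff d f ps) \<and>
      (\<forall>ps\<in>partitions e. 0 \<le> monomial_coeff e g ps) \<and>
      strongly_nice d f \<and> strongly_nice e g"
  then show "strongly_nice (d + e) (f \<otimes> g)"
    by (intro strongly_nice_mult) (auto intro: coeff_nonneg)
next
  assume *: "simple_graph V E \<and> simple_graph W F \<and>
      strongly_nice_graph V E \<and> strongly_nice_graph W F"
  then have fin: "finite V" "finite W" by (auto simp: simple_graph_def)
  have "strongly_nice (card V + card W) (chromatic_sym V E \<otimes> chromatic_sym W F)"
    using * by (intro strongly_nice_mult) (auto simp: strongly_nice_graph_def chromatic_sym_def)
  then show "strongly_nice_graph (V <+> W) (disjoint_union_edges E F)"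
    by (simp add: strongly_nice_graph_def chromatic_sym_disjoint_union fin card_Plus)
qed

end
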